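(* The group $L_2=\langle a,t \mid a^2,\ [t^{i}at^{-i},t^{j}at^{-j}],\ i,j\in\mathbb{Z}\rangle$ has infinitely many cone types with respect to the generating set $\{t,ta\}$.
   Context: $L_2$ is the lamplighter group, i.e. the wreath product $\mathbb{Z}_2\wr\mathbb{Z}$, where $a$ generates $\mathbb{Z}_2$ and $t$ generates $\mathbb{Z}$; $\{t,ta\}$ is called its automata generating set. Let $G$ be a group with the word metric $d$ of a finite generating set $X$. A path $p$ in the Cayley graph is outbound if $d(1,p(s))$ is a strictly increasing function of $s$. The cone at $g\in G$ is the set $C'(g)$ of all outbound paths starting at $g$, and the cone type of $g$ is $C(g)=g^{-1}C'(g)$. (In the discrete setting, paths are edge paths, and $C(g)$ can be identified with the set of words $x_1\cdots x_n$ over $X\cup X^{-1}$ such that $d(1,gx_1\cdots x_i)=d(1,g)+i$ for all $1\le i\le n$.) *)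

theory Defs
  imports "HOL-Algebra.Generated_Groups"
begin

section \<open>Group presentations\<close>

text \<open>A letter \<open>(x, True)\<close> stands for the generator \<open>x\<close> and \<open>(x, False)\<close> for its formal inverse.\<close>

type_synonym 'x word = "('x \<times> bool) list"

definition word_inv :: "'x word \<Rightarrow> 'x word" where
  "word_inv w = rev (map (\<lambda>(x, e). (x, \<not> e)) w)"

definition word_commutator :: "'x word \<Rightarrow> 'x word \<Rightarrow> 'x word" where
  "word_commutator u v = u @ v @ word_inv u @ word_inv v"

text \<open>Two words are related iff they represent the same element of the group presented by the
  generators \<open>'x\<close> and the relators \<open>R\<close>.\<close>

inductive pres_eq :: "'x word set \<Rightarrow> 'x word \<Rightarrow> 'x word \<Rightarrow> bool" for R where
  refl: "pres_eq R w w"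
| sym: "pres_eq R u v \<Longrightarrow> pres_eq R v u"
| trans: "pres_eq R u v \<Longrightarrow> pres_eq R v w \<Longrightarrow> pres_eq R u w"
| cancel: "pres_eq R (u @ [(x, e), (x, \<not> e)] @ v) (u @ v)"
| relator: "r \<in> R \<Longrightarrow> pres_eq R (u @ r @ v) (u @ v)"

definition word_class :: "'x word set \<Rightarrow> 'x word \<Rightarrow> 'x word set" where
  "word_class R w = {v. pres_eq R w v}"

definition presented_group :: "'x word set \<Rightarrow> 'x word set monoid" where
  "presented_group R =
    \<lparr>carrier = range (word_class R),
     monoid.mult = (\<lambda>A B. \<Union>u\<in>A. \<Union>v\<in>B. word_class R (u @ v)),
     one = word_class R []\<rparr>"

lemma word_class_eq_iff: "word_class R u = word_class R v \<longleftrightarrow> pres_eq R u v"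
proof
  assume "word_class R u = word_class R v"
  then show "pres_eq R u v" using pres_eq.refl[of R v] by (auto simp: word_class_def)
next
  assume "pres_eq R u v"
  then have "pres_eq R u w \<longleftrightarrow> pres_eq R v w" for w
    by (meson pres_eq.sym pres_eq.trans)
  then show "word_class R u = word_class R v" by (simp add: word_class_def)
qed

lemma pres_eq_append_left: "pres_eq R u v \<Longrightarrow> pres_eq R (w @ u) (w @ v)"
proof (induction rule: pres_eq.induct)
  case (cancel u x e v)
  show ?case using pres_eq.cancel[of R "w @ u" x e v] by simp
next
  case (relator r u v)
  then show ?case using pres_eq.relator[of r R "w @ u" v] by simp
next
  case (trans u v z)
  then show ?case using pres_eq.trans by blast
qed (simp_all add: pres_eq.refl pres_eq.sym)

lemma pres_eq_append_right: "pres_eq R u v \<Longrightarrow> pres_eq R (u @ w) (v @ w)"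
proof (induction rule: pres_eq.induct)
  case (cancel u x e v)
  show ?case using pres_eq.cancel[of R u x e "v @ w"] by simp
next
  case (relator r u v)
  then show ?case using pres_eq.relator[of r R u "v @ w"] by simp
next
  case (trans u v z)
  then show ?case using pres_eq.trans by blast
qed (simp_all add: pres_eq.refl pres_eq.sym)

lemma pres_eq_append:
  "pres_eq R u u' \<Longrightarrow> pres_eq R v v' \<Longrightarrow> pres_eq R (u @ v) (u' @ v')"
  by (meson pres_eq.trans pres_eq_append_left pres_eq_append_right)

lemma pres_eq_word_inv_left: "pres_eq R (word_inv w @ w) []"
proof (induction w)
  case Nil
  show ?case by (simp add: word_inv_def pres_eq.refl)
next
  case (Cons l w)
  obtain x e where l: "l = (x, e)" by fastforce
  have "pres_eq R (word_inv w @ [(x, \<not> e), (x, \<not> \<not> e)] @ w) (word_inv w @ w)"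
    by (rule pres_eq.cancel)
  then have "pres_eq R (word_inv (l # w) @ (l # w)) (word_inv w @ w)"
    by (simp add: l word_inv_def)
  then show ?case using Cons.IH pres_eq.trans by blast
qed

lemma presented_group_mult:
  "word_class R u \<otimes>\<^bsub>presented_group R\<^esub> word_class R v = word_class R (u @ v)"
proof -
  have eq: "word_class R (u' @ v') = word_class R (u @ v)"
    if "u' \<in> word_class R u" "v' \<in> word_class R v" for u' v'
  proof -
    have "pres_eq R (u @ v) (u' @ v')"
      using that by (simp add: word_class_def pres_eq_append)
    then show ?thesis by (simp add: word_class_eq_iff pres_eq.sym)
  qed
  have mem: "u \<in> word_class R u" "v \<in> word_class R v"
    by (simp_all add: word_class_def pres_eq.refl)
  have "(\<Union>u'\<in>word_class R u. \<Union>v'\<in>word_class R v. word_class R (u' @ v')) =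
      (\<Union>u'\<in>word_class R u. \<Union>v'\<in>word_class R v. word_class R (u @ v))"
    by ((rule SUP_cong, rule HOL.refl)+, rule eq)
  also have "\<dots> = word_class R (u @ v)" using mem by blast
  finally show ?thesis by (simp add: presented_group_def)
qed

lemma presented_group_one: "\<one>\<^bsub>presented_group R\<^esub> = word_class R []"
  by (simp add: presented_group_def)

lemma presented_group_carrier: "carrier (presented_group R) = range (word_class R)"
  by (simp add: presented_group_def)

lemma group_presented_group: "group (presented_group R)"
proof (rule groupI)
  fix A assume "A \<in> carrier (presented_group R)"
  then obtain w where w: "A = word_class R w" by (auto simp: presented_group_carrier)
  have "word_class R (word_inv w) \<otimes>\<^bsub>presented_group R\<^esub> A = \<one>\<^bsub>presented_group R\<^esub>"
    by (simp add: w presented_group_mult presented_group_one word_class_eq_iff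
        pres_eq_word_inv_left)
  then show "\<exists>B\<in>carrier (presented_group R). B \<otimes>\<^bsub>presented_group R\<^esub> A = \<one>\<^bsub>presented_group R\<^esub>"
    by (auto simp: presented_group_carrier)
qed (auto simp: presented_group_carrier presented_group_mult presented_group_one)


section \<open>The lamplighter group\<close>

datatype lamp_gen = gen_a | gen_t

definition a_word :: "lamp_gen word" where
  "a_word = [(gen_a, True)]"

definition t_power_word :: "int \<Rightarrow> lamp_gen word" where
  "t_power_word i = replicate (nat \<bar>i\<bar>) (gen_t, 0 \<le> i)"

definition a_conj_word :: "int \<Rightarrow> lamp_gen word" where
  "a_conj_word i = t_power_word i @ a_word @ t_power_word (- i)"

definition lamp_relators :: "lamp_gen word set" where
  "lamp_relators =
    insert (a_word @ a_word)
      {word_commutator (a_conj_word i) (a_conj_word j) | i j :: int. True}"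

definition L2 :: "lamp_gen word set monoid" where
  "L2 = presented_group lamp_relators"

definition L2_a :: "lamp_gen word set" where
  "L2_a = word_class lamp_relators [(gen_a, True)]"

definition L2_t :: "lamp_gen word set" where
  "L2_t = word_class lamp_relators [(gen_t, True)]"

definition automata_gens :: "lamp_gen word set set" where
  "automata_gens = {L2_t, L2_t \<otimes>\<^bsub>L2\<^esub> L2_a}"

lemma group_L2: "group L2"
  by (simp add: L2_def group_presented_group)

lemma generate_automata_gens: "generate L2 automata_gens = carrier L2"
proof
  interpret group L2 by (rule group_L2)
  let ?H = "generate L2 automata_gens"
  have at: "L2_a \<in> carrier L2" "L2_t \<in> carrier L2"
    by (auto simp: L2_a_def L2_t_def L2_def presented_group_carrier)
  then have sub: "automata_gens \<subseteq> carrier L2" by (auto simp: automata_gens_def)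
  show "?H \<subseteq> carrier L2" using generate_incl[OF sub] .
  interpret H: subgroup ?H L2 using generate_is_subgroup[OF sub] .
  have tH: "L2_t \<in> ?H" and taH: "L2_t \<otimes>\<^bsub>L2\<^esub> L2_a \<in> ?H"
    by (auto simp: automata_gens_def intro: generate.incl)
  have "inv\<^bsub>L2\<^esub> L2_t \<otimes>\<^bsub>L2\<^esub> (L2_t \<otimes>\<^bsub>L2\<^esub> L2_a) \<in> ?H" using tH taH by blast
  then have aH: "L2_a \<in> ?H" using at by (simp add: m_assoc[symmetric])
  have letter: "word_class lamp_relators [(x, e)] \<in> ?H" for x e
  proof -
    have pos: "word_class lamp_relators [(x, True)] \<in> ?H"
      using tH aH by (cases x) (auto simp: L2_a_def L2_t_def)
    have "word_class lamp_relators [(x, False)] \<otimes>\<^bsub>L2\<^esub> word_class lamp_relators [(x, True)] = \<one>\<^bsub>L2\<^esub>"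
      using pres_eq_word_inv_left[of lamp_relators "[(x, True)]"]
      by (simp add: L2_def presented_group_mult presented_group_one word_class_eq_iff word_inv_def)
    then have "inv\<^bsub>L2\<^esub> word_class lamp_relators [(x, True)] = word_class lamp_relators [(x, False)]"
      by (intro inv_equality) (auto simp: L2_def presented_group_carrier)
    then show ?thesis using pos H.m_inv_closed by (cases e) metis+
  qed
  have "word_class lamp_relators w \<in> ?H" for w
  proof (induction w)
    case Nil
    show ?case using H.one_closed by (simp add: L2_def presented_group_one)
  next
    case (Cons l w)
    have "word_class lamp_relators [l] \<otimes>\<^bsub>L2\<^esub> word_class lamp_relators w \<in> ?H"
      using letter Cons.IH by (cases l) auto
    then show ?case by (simp add: L2_def presented_group_mult)
  qed
  then show "carrier L2 \<subseteq> ?H" by (auto simp: L2_def presented_group_carrier)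
qed


section \<open>Cone types\<close>

definition sym_gens :: "('a, 'b) monoid_scheme \<Rightarrow> 'a set \<Rightarrow> 'a set" where
  "sym_gens G X = X \<union> m_inv G ` X"

definition word_length :: "('a, 'b) monoid_scheme \<Rightarrow> 'a set \<Rightarrow> 'a \<Rightarrow> nat" where
  "word_length G X g =
    (LEAST n. \<exists>xs\<in>lists (sym_gens G X). length xs = n \<and> foldr (\<otimes>\<^bsub>G\<^esub>) xs \<one>\<^bsub>G\<^esub> = g)"

definition word_dist :: "('a, 'b) monoid_scheme \<Rightarrow> 'a set \<Rightarrow> 'a \<Rightarrow> 'a \<Rightarrow> nat" where
  "word_dist G X g h = word_length G X (inv\<^bsub>G\<^esub> g \<otimes>\<^bsub>G\<^esub> h)"

text \<open>Edge paths in the (right) Cayley graph, given by their nonempty vertex sequences.\<close>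

definition cayley_path :: "('a, 'b) monoid_scheme \<Rightarrow> 'a set \<Rightarrow> 'a list \<Rightarrow> bool" where
  "cayley_path G X p \<longleftrightarrow> p \<noteq> [] \<and> set p \<subseteq> carrier G \<and>
    (\<forall>i. Suc i < length p \<longrightarrow> (\<exists>x\<in>sym_gens G X. p ! Suc i = p ! i \<otimes>\<^bsub>G\<^esub> x))"

definition outbound :: "('a, 'b) monoid_scheme \<Rightarrow> 'a set \<Rightarrow> 'a list \<Rightarrow> bool" where
  "outbound G X p \<longleftrightarrow>
    (\<forall>i j. i < j \<and> j < length p \<longrightarrow>
      word_dist G X \<one>\<^bsub>G\<^esub> (p ! i) < word_dist G X \<one>\<^bsub>G\<^esub> (p ! j))"

definition cone :: "('a, 'b) monoid_scheme \<Rightarrow> 'a set \<Rightarrow> 'a \<Rightarrow> 'a list set" where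
  "cone G X g = {p. cayley_path G X p \<and> outbound G X p \<and> hd p = g}"

definition cone_type :: "('a, 'b) monoid_scheme \<Rightarrow> 'a set \<Rightarrow> 'a \<Rightarrow> 'a list set" where
  "cone_type G X g = map (\<lambda>h. inv\<^bsub>G\<^esub> g \<otimes>\<^bsub>G\<^esub> h) ` cone G X g"

end

theory Submission
  imports Defs
begin

text \<open>
  Identify the lamp at position \<open>k\<close> with the edge of \<open>\<int>\<close> from \<open>k - 1\<close> to \<open>k\<close>. A generator
  \<open>t\<close> or \<open>ta\<close> (or its inverse) moves the lamplighter across one edge, with the option of toggling
  that edge. The length of an element is therefore the length of a shortest walk from \<open>0\<close> to the
  final position that crosses every lit edge. Take the element with lamps \<open>0\<close> and \<open>n + 1\<close> lit and
  the lamplighter at \<open>n\<close>. A shortest walk to the position \<open>n - i\<close> with \<open>0 \<le> i \<le> n\<close> visits \<open>- 1\<close>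
  first, then \<open>n + 1\<close>, so it has length \<open>n + 4 + i\<close>; but at \<open>- 1\<close> it is shorter to
  visit \<open>n + 1\<close> first. Hence the path \<open>1, t\<^sup>-\<^sup>1, t\<^sup>-\<^sup>2, \<dots>\<close> is outbound for exactly \<open>n\<close> steps.
\<close>

section \<open>Action on lamp configurations\<close>

text \<open>A state is a pair of lamps and position. Words are read from left to right, so appending
  a letter is right multiplication, as along Cayley graph edges. Both signs of \<open>gen_a\<close>
  toggle because \<open>a\<close> is an involution.\<close>

fun letter_act :: "lamp_gen \<times> bool \<Rightarrow> (int \<Rightarrow> bool) \<times> int \<Rightarrow> (int \<Rightarrow> bool) \<times> int" where
  "letter_act (gen_a, e) (l, k) = (l(k := \<not> l k), k)"
| "letter_act (gen_t, e) (l, k) = (l, if e then k + 1 else k - 1)"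

definition word_act :: "lamp_gen word \<Rightarrow> (int \<Rightarrow> bool) \<times> int \<Rightarrow> (int \<Rightarrow> bool) \<times> int" where
  "word_act = fold letter_act"

lemma word_act_Nil [simp]: "word_act [] s = s"
  by (simp add: word_act_def)

lemma word_act_Cons [simp]: "word_act (x # w) s = word_act w (letter_act x s)"
  by (simp add: word_act_def)

lemma word_act_append [simp]: "word_act (u @ v) s = word_act v (word_act u s)"
  by (simp add: word_act_def)

lemma letter_act_cancel [simp]: "letter_act (x, \<not> e) (letter_act (x, e) s) = s"
  by (cases s; cases x; cases e) auto

lemma word_act_word_inv [simp]: "word_act (word_inv w) (word_act w s) = s"
proof (induction w arbitrary: s)
  case Nil
  then show ?case by (simp add: word_inv_def)
next
  case (Cons x w)
  obtain y e where "x = (y, e)" by fastforce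
  moreover have "word_inv (x # w) = word_inv w @ word_inv [x]"
    by (simp add: word_inv_def)
  ultimately show ?case by (simp add: Cons.IH) (simp add: word_inv_def)
qed

lemma word_act_commutator:
  assumes "\<And>s. word_act u (word_act v s) = word_act v (word_act u s)"
  shows "word_act (word_commutator u v) s = s"
  by (simp add: word_commutator_def flip: assms)

lemma word_act_replicate_t:
  "word_act (replicate m (gen_t, e)) (l, k) = (l, if e then k + int m else k - int m)"
  by (induction m arbitrary: k) auto

lemma word_act_t_power: "word_act (t_power_word i) (l, k) = (l, k + i)"
  by (auto simp: t_power_word_def word_act_replicate_t)

lemma word_act_a_conj: "word_act (a_conj_word i) (l, k) = (l(k + i := \<not> l (k + i)), k)"
  by (simp add: a_conj_word_def a_word_def word_act_t_power)

lemma word_act_relator: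
  assumes "r \<in> lamp_relators"
  shows "word_act r s = s"
proof -
  have comm: "word_act (word_commutator (a_conj_word i) (a_conj_word j)) s = s" for i j
  proof (rule word_act_commutator)
    fix s show "word_act (a_conj_word i) (word_act (a_conj_word j) s) =
        word_act (a_conj_word j) (word_act (a_conj_word i) s)"
      by (cases s) (auto simp: word_act_a_conj fun_eq_iff)
  qed
  have "word_act (a_word @ a_word) s = s"
    by (cases s) (simp add: a_word_def)
  with assms comm show ?thesis
    unfolding lamp_relators_def by blast
qed

text \<open>Hence the state reached from the origin depends only on the element of
  \<open>L2\<close>; lower bounds on length are read off from it.\<close>

lemma pres_eq_word_act:
  assumes "pres_eq lamp_relators u v"
  shows "word_act u s = word_act v s"
  using assms by (induction arbitrary: s rule: pres_eq.induct) (auto simp: word_act_relator)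

section \<open>Word length\<close>

text \<open>The last two words are literally the \<open>word_inv\<close> of the first two, hence the
  sign \<open>False\<close> at \<open>gen_a\<close>.\<close>

definition automata_words :: "lamp_gen word set" where
  "automata_words =
    {[(gen_t, True)], [(gen_t, True), (gen_a, True)], [(gen_t, False)],
     [(gen_a, False), (gen_t, False)]}"

lemma inv_word_class: "inv\<^bsub>presented_group R\<^esub> word_class R w = word_class R (word_inv w)"
proof -
  interpret group "presented_group R" by (rule group_presented_group)
  show ?thesis
    by (rule inv_equality)
      (auto simp: presented_group_carrier presented_group_mult presented_group_one
        word_class_eq_iff pres_eq_word_inv_left)
qed

lemma sym_gens_automata: "sym_gens L2 automata_gens = word_class lamp_relators ` automata_words"
  by (auto simp: sym_gens_def automata_gens_def automata_words_def L2_t_def L2_a_def L2_def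
      presented_group_mult inv_word_class word_inv_def)

lemma foldr_word_class:
  "foldr (\<otimes>\<^bsub>presented_group R\<^esub>) (map (word_class R) ws) \<one>\<^bsub>presented_group R\<^esub> =
    word_class R (concat ws)"
  by (induction ws) (auto simp: presented_group_mult presented_group_one)

abbreviation automata_length :: "lamp_gen word \<Rightarrow> nat" where
  "automata_length w \<equiv> word_length L2 automata_gens (word_class lamp_relators w)"

lemma automata_length_eq:
  "automata_length w =
    (LEAST n. \<exists>ws\<in>lists automata_words. length ws = n \<and> pres_eq lamp_relators (concat ws) w)"
  by (simp add: word_length_def sym_gens_automata lists_image)
    (simp add: L2_def foldr_word_class word_class_eq_iff)

lemma automata_length_le:
  assumes "ws \<in> lists automata_words" "pres_eq lamp_relators (concat ws) w"
  shows "automata_length w \<le> length ws"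
  unfolding automata_length_eq by (rule Least_le) (use assms in blast)

text \<open>The length of a shortest walk from \<open>0\<close> to \<open>k\<close> crossing the lit ones among the edges
  \<open>0\<close> and \<open>n + 1\<close>.\<close>

fun walk_bound :: "nat \<Rightarrow> (int \<Rightarrow> bool) \<times> int \<Rightarrow> int" where
  "walk_bound n (l, k) =
    (if l 0 then
       if l (int n + 1) then
         if int n + 1 \<le> k then k + 2 else if 0 \<le> k then 2 * int n + 4 - k else 2 * int n + 2 - k
       else if k < 0 then - k else k + 2
     else if l (int n + 1) then if int n + 1 \<le> k then k else 2 * int n + 2 - k
     else \<bar>k\<bar>)"

text \<open>A factor crosses one edge and toggles at most that edge, so a walk serving the old
  state, extended by this crossing, serves the new one.\<close>

lemma walk_bound_step:
  assumes "w \<in> automata_words"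
  shows "walk_bound n (word_act w s) \<le> walk_bound n s + 1"
  using assms by (cases s) (auto simp: automata_words_def)

lemma walk_bound_concat:
  assumes "ws \<in> lists automata_words"
  shows "walk_bound n (word_act (concat ws) s) \<le> walk_bound n s + int (length ws)"
  using assms
proof (induction ws arbitrary: s)
  case (Cons w ws)
  have "walk_bound n (word_act (concat ws) (word_act w s))
      \<le> walk_bound n (word_act w s) + int (length ws)"
    by (rule Cons.IH)
  with walk_bound_step[OF Cons.hyps(1), of n s] show ?case by simp
qed simp

lemma walk_bound_le_automata_length:
  assumes "ws \<in> lists automata_words" "pres_eq lamp_relators (concat ws) w"
  shows "walk_bound n (word_act w ((\<lambda>_. False), 0)) \<le> int (automata_length w)"
proof -
  \<comment> \<open>The given factorization ensures that the \<open>LEAST\<close> defining the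
    length is attained.\<close>
  have "\<exists>m. \<exists>ws\<in>lists automata_words. length ws = m \<and> pres_eq lamp_relators (concat ws) w"
    using assms by blast
  from LeastI_ex[OF this] obtain vs where vs: "vs \<in> lists automata_words"
      "length vs = automata_length w" "pres_eq lamp_relators (concat vs) w"
    unfolding automata_length_eq[symmetric] by blast
  show ?thesis
    using walk_bound_concat[OF vs(1), of n "(\<lambda>_. False, 0)"] vs(2)
    by (simp add: pres_eq_word_act[OF vs(3)])
qed

section \<open>Elements with two lit lamps\<close>

text \<open>The itinerary: light edge \<open>0\<close> going to \<open>- 1\<close>, walk right to
  \<open>n\<close>, light edge \<open>n + 1\<close>, walk back to \<open>n - i\<close>. Keeping the
  factors separate makes the length of the list, \<open>n + 4 + i\<close>, an upper bound.\<close>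

definition two_lamp_factors :: "nat \<Rightarrow> nat \<Rightarrow> lamp_gen word list" where
  "two_lamp_factors n i =
    [(gen_a, False), (gen_t, False)] # replicate (Suc n) [(gen_t, True)] @
    [(gen_t, True), (gen_a, True)] # replicate (Suc i) [(gen_t, False)]"

definition two_lamp_word :: "nat \<Rightarrow> nat \<Rightarrow> lamp_gen word" where
  "two_lamp_word n i = concat (two_lamp_factors n i)"

lemma concat_replicate_singleton: "concat (replicate m [x]) = replicate m x"
  by (induction m) auto

lemma two_lamp_word_append: "two_lamp_word n i = two_lamp_word n 0 @ replicate i (gen_t, False)"
  by (simp add: two_lamp_word_def two_lamp_factors_def concat_replicate_singleton)

lemma two_lamp_factors_in: "two_lamp_factors n i \<in> lists automata_words"
  by (auto simp: two_lamp_factors_def automata_words_def in_lists_conv_set)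

lemma word_act_two_lamp_word:
  "word_act (two_lamp_word n i) (\<lambda>_. False, 0) =
    ((\<lambda>_. False)(0 := True, int n + 1 := True), int n - int i)"
  by (simp add: two_lamp_word_def two_lamp_factors_def concat_replicate_singleton
      word_act_replicate_t algebra_simps)

lemma automata_length_two_lamp_word:
  assumes "i \<le> n"
  shows "automata_length (two_lamp_word n i) = n + 4 + i"
proof (rule antisym)
  show "automata_length (two_lamp_word n i) \<le> n + 4 + i"
    using automata_length_le[OF two_lamp_factors_in, of n i "two_lamp_word n i"]
    by (simp add: two_lamp_word_def pres_eq.refl) (simp add: two_lamp_factors_def)
  have "walk_bound n (word_act (two_lamp_word n i) (\<lambda>_. False, 0))
      \<le> int (automata_length (two_lamp_word n i))"
    by (rule walk_bound_le_automata_length[OF two_lamp_factors_in[of n i]])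
      (simp add: two_lamp_word_def pres_eq.refl)
  then show "n + 4 + i \<le> automata_length (two_lamp_word n i)"
    using assms by (simp add: word_act_two_lamp_word)
qed

text \<open>The relator gives \<open>u v u^-1 = v\<close>; multiply by \<open>u^-1\<close> on the
  left. With \<open>u = a\<close> this moves the letter \<open>(gen_a, False)\<close> past
  \<open>v\<close>.\<close>

lemma pres_eq_commute:
  assumes "word_commutator u v \<in> R"
  shows "pres_eq R (v @ word_inv u) (word_inv u @ v)"
proof -
  have "pres_eq R (word_commutator u v @ v) v"
    using pres_eq.relator[OF assms, of "[]" v] by simp
  moreover have "pres_eq R (word_commutator u v @ v) (u @ v @ word_inv u)"
    using pres_eq_append_left[OF pres_eq_word_inv_left, of R "u @ v @ word_inv u" v]
    by (simp add: word_commutator_def)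
  ultimately have "pres_eq R (u @ v @ word_inv u) v"
    by (meson pres_eq.sym pres_eq.trans)
  then have "pres_eq R (word_inv u @ u @ v @ word_inv u) (word_inv u @ v)"
    by (rule pres_eq_append_left)
  moreover have "pres_eq R (word_inv u @ u @ v @ word_inv u) (v @ word_inv u)"
    using pres_eq_append_right[OF pres_eq_word_inv_left, of R u "v @ word_inv u"] by simp
  ultimately show ?thesis
    by (meson pres_eq.sym pres_eq.trans)
qed

text \<open>The lamps commute, so edge \<open>n + 1\<close> can be lit first and edge
  \<open>0\<close> on the final step from \<open>0\<close> to \<open>- 1\<close>.\<close>

lemma automata_length_two_lamp_word_Suc:
  "automata_length (two_lamp_word n (Suc n)) \<le> 2 * n + 3"
proof -
  let ?v = "a_conj_word (int (Suc n))"
  have v: "?v = replicate n (gen_t, True) @ [(gen_t, True), (gen_a, True)] @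
      replicate (Suc n) (gen_t, False)"
    by (simp add: a_conj_word_def a_word_def t_power_word_def nat_add_distrib
        flip: replicate_append_same)
  have a: "a_conj_word 0 = [(gen_a, True)]"
    by (simp add: a_conj_word_def a_word_def t_power_word_def)
  have "word_commutator (a_conj_word 0) ?v \<in> lamp_relators"
    unfolding lamp_relators_def by blast
  then have comm: "pres_eq lamp_relators (?v @ [(gen_a, False)]) ([(gen_a, False)] @ ?v)"
    using pres_eq_commute[of "a_conj_word 0" ?v] by (simp add: a word_inv_def)
  \<comment> \<open>The reversed itinerary: \<open>n + 1\<close> steps out, \<open>n + 1\<close>
    back to \<open>0\<close>, one to \<open>- 1\<close>.\<close>
  let ?ws = "replicate n [(gen_t, True)] @ [(gen_t, True), (gen_a, True)] #
      replicate (Suc n) [(gen_t, False)] @ [[(gen_a, False), (gen_t, False)]]"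
  have ws: "?ws \<in> lists automata_words"
    by (auto simp: automata_words_def in_lists_conv_set)
  have "concat ?ws = (?v @ [(gen_a, False)]) @ [(gen_t, False)]"
    by (simp add: v concat_replicate_singleton del: of_nat_Suc)
  moreover have "pres_eq lamp_relators \<dots> (([(gen_a, False)] @ ?v) @ [(gen_t, False)])"
    by (rule pres_eq_append_right[OF comm])
  moreover have "pres_eq lamp_relators (two_lamp_word n (Suc n))
      (([(gen_a, False)] @ ?v) @ [(gen_t, False)])"
  proof -
    \<comment> \<open>The detour to \<open>- 1\<close> and back leaves \<open>t^-1 t\<close>,
      written with \<open>\<not> False\<close> to match \<open>pres_eq.cancel\<close>.\<close>
    have "two_lamp_word n (Suc n) = [(gen_a, False)] @ [(gen_t, False), (gen_t, \<not> False)] @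
        (?v @ [(gen_t, False)])"
      by (simp add: v two_lamp_word_def two_lamp_factors_def concat_replicate_singleton
          replicate_append_same del: of_nat_Suc)
    then show ?thesis
      using pres_eq.cancel[of lamp_relators "[(gen_a, False)]" gen_t False "?v @ [(gen_t, False)]"]
      by simp
  qed
  ultimately have "pres_eq lamp_relators (concat ?ws) (two_lamp_word n (Suc n))"
    by (metis pres_eq.sym pres_eq.trans)
  from automata_length_le[OF ws this] show ?thesis by simp
qed

section \<open>Cone types\<close>

definition two_lamp_element :: "nat \<Rightarrow> nat \<Rightarrow> lamp_gen word set" where
  "two_lamp_element n i = word_class lamp_relators (two_lamp_word n i)"

text \<open>Based at the identity and independent of \<open>n\<close>, so that one path can be
  tested against the cone types of all two-lamp elements.\<close>

definition descending_path :: "nat \<Rightarrow> lamp_gen word set list" where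
  "descending_path m =
    map (\<lambda>i. word_class lamp_relators (replicate i (gen_t, False))) [0..<Suc m]"

lemma word_class_in_carrier: "word_class lamp_relators w \<in> carrier L2"
  by (simp add: L2_def presented_group_carrier)

lemma two_lamp_element_in_carrier: "two_lamp_element n i \<in> carrier L2"
  by (simp add: two_lamp_element_def word_class_in_carrier)

lemma two_lamp_element_mult:
  "two_lamp_element n 0 \<otimes>\<^bsub>L2\<^esub> word_class lamp_relators (replicate i (gen_t, False)) =
    two_lamp_element n i"
  by (simp add: two_lamp_element_def L2_def presented_group_mult flip: two_lamp_word_append)

lemma length_two_lamp_element:
  "i \<le> n \<Longrightarrow> word_length L2 automata_gens (two_lamp_element n i) = n + 4 + i"
  by (simp add: two_lamp_element_def automata_length_two_lamp_word)

lemma word_dist_one: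
  assumes "g \<in> carrier L2"
  shows "word_dist L2 X \<one>\<^bsub>L2\<^esub> g = word_length L2 X g"
proof -
  interpret group L2 by (rule group_L2)
  show ?thesis using assms by (simp add: word_dist_def)
qed

lemma descending_path_in_cone_type:
  "descending_path n \<in> cone_type L2 automata_gens (two_lamp_element n 0)"
proof -
  interpret group L2 by (rule group_L2)
  \<comment> \<open>The translate of the path; its vertices have lengths \<open>n + 4 + i\<close>,
    increasing in \<open>i\<close>.\<close>
  let ?q = "map (two_lamp_element n) [0..<Suc n]"
  have nth: "?q ! i = two_lamp_element n i" if "i < Suc n" for i
    using that by (simp del: upt_Suc)
  have "two_lamp_element n (Suc i) =
      two_lamp_element n i \<otimes>\<^bsub>L2\<^esub> word_class lamp_relators [(gen_t, False)]" for i
  proof -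
    have "two_lamp_word n (Suc i) = two_lamp_word n i @ [(gen_t, False)]"
      by (simp add: two_lamp_word_append[of n i] two_lamp_word_append[of n "Suc i"]
          replicate_append_same)
    then show ?thesis by (simp add: two_lamp_element_def L2_def presented_group_mult)
  qed
  then have step: "\<exists>x\<in>sym_gens L2 automata_gens.
      two_lamp_element n (Suc i) = two_lamp_element n i \<otimes>\<^bsub>L2\<^esub> x" for i
    by (auto simp: sym_gens_automata automata_words_def)
  have "cayley_path L2 automata_gens ?q"
    unfolding cayley_path_def using step nth
    by (auto simp: two_lamp_element_in_carrier simp del: upt_Suc)
  moreover have "outbound L2 automata_gens ?q"
    unfolding outbound_def using nth
    by (auto simp: word_dist_one two_lamp_element_in_carrier length_two_lamp_element
        simp del: upt_Suc)
  moreover have "hd ?q = two_lamp_element n 0"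
    by (simp add: hd_map del: upt_Suc)
  ultimately have "?q \<in> cone L2 automata_gens (two_lamp_element n 0)"
    by (simp add: cone_def)
  moreover have "descending_path n = map (\<lambda>h. inv\<^bsub>L2\<^esub> two_lamp_element n 0 \<otimes>\<^bsub>L2\<^esub> h) ?q"
  proof -
    have "inv\<^bsub>L2\<^esub> two_lamp_element n 0 \<otimes>\<^bsub>L2\<^esub> two_lamp_element n i =
        word_class lamp_relators (replicate i (gen_t, False))" for i
      by (rule inv_solve_left'[THEN iffD2])
        (auto simp: two_lamp_element_in_carrier two_lamp_element_mult word_class_in_carrier)
    then show ?thesis by (simp add: descending_path_def del: upt_Suc)
  qed
  ultimately show ?thesis unfolding cone_type_def by blast
qed

text \<open>Cancelling the translation forces the vertices of any outbound preimage. Its step from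
  index \<open>n\<close> to \<open>n + 1\<close> would drop the length from \<open>2 * n + 4\<close>
  to at most \<open>2 * n + 3\<close>.\<close>

lemma descending_path_notin_cone_type:
  assumes "n < m"
  shows "descending_path m \<notin> cone_type L2 automata_gens (two_lamp_element n 0)"
proof
  interpret group L2 by (rule group_L2)
  let ?g = "two_lamp_element n 0"
  assume "descending_path m \<in> cone_type L2 automata_gens ?g"
  then obtain q where path: "cayley_path L2 automata_gens q" and out: "outbound L2 automata_gens q"
    and q: "descending_path m = map (\<lambda>h. inv\<^bsub>L2\<^esub> ?g \<otimes>\<^bsub>L2\<^esub> h) q"
    by (auto simp: cone_type_def cone_def)
  have len: "length q = Suc m"
    using arg_cong[OF q, of length] by (simp add: descending_path_def)
  have nth: "q ! i = two_lamp_element n i" if "i \<le> m" for i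
  proof -
    have "q ! i \<in> carrier L2"
      using path len that by (auto simp: cayley_path_def)
    moreover have "word_class lamp_relators (replicate i (gen_t, False)) =
        inv\<^bsub>L2\<^esub> ?g \<otimes>\<^bsub>L2\<^esub> q ! i"
      using arg_cong[OF q, of "\<lambda>xs. xs ! i"] len that
      by (simp add: descending_path_def del: upt_Suc)
    ultimately show ?thesis
      using two_lamp_element_mult[of n i] two_lamp_element_in_carrier[of n 0]
      by (simp flip: m_assoc)
  qed
  have "word_dist L2 automata_gens \<one>\<^bsub>L2\<^esub> (q ! n) < word_dist L2 automata_gens \<one>\<^bsub>L2\<^esub> (q ! Suc n)"
    using out len assms by (auto simp: outbound_def)
  then have "automata_length (two_lamp_word n n) < automata_length (two_lamp_word n (Suc n))"
    using assms by (simp add: nth word_dist_one two_lamp_element_in_carrier)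
      (simp add: two_lamp_element_def)
  then show False
    using automata_length_two_lamp_word_Suc[of n] by (simp add: automata_length_two_lamp_word)
qed

theorem corollary23:
  shows "infinite (cone_type L2 automata_gens ` carrier L2)"
proof -
  let ?c = "\<lambda>n. cone_type L2 automata_gens (two_lamp_element n 0)"
  have "inj ?c"
    \<comment> \<open>For \<open>n < m\<close>, \<open>descending_path m\<close> lies in the cone
      type for \<open>m\<close> but not in that for \<open>n\<close>.\<close>
    by (rule linorder_injI)
      (metis descending_path_in_cone_type descending_path_notin_cone_type)
  then have "infinite (range ?c)" by (simp add: finite_image_iff)
  moreover have "range ?c \<subseteq> cone_type L2 automata_gens ` carrier L2"
    using two_lamp_element_in_carrier by blast
  ultimately show ?thesis using infinite_super by blast
qed

end
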